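(* In LP$^{\mathrm{MLN}}$ (i.e. with respect to semi-strong equivalence $\equiv_{s,s}$): the S-EX-0 transformation is neither SE-preserving nor NSE-preserving; and the S-EX-1 transformation is NSE-preserving but not SE-preserving.
   Context: Atoms are propositional. A rule $r$ is an expression $h_1\vee\cdots\vee h_k\leftarrow b_1,\dots,b_m,\mathit{not}\,c_1,\dots,\mathit{not}\,c_n$; write $H(r)$, $B^+(r)$, $B^-(r)$ for the sets of head, positive body and negative body atoms. A program is a finite set of rules. An interpretation $X$ satisfies $r$ iff $X\cap H(r)\neq\emptyset$ or $B^+(r)\not\subseteq X$ or $B^-(r)\cap X\neq\emptyset$. GL-reduct $P^X=\{H(r)\leftarrow B^+(r) : r\in P,\ B^-(r)\cap X=\emptyset\}$; $X$ is an ASP stable model of $P$ iff $X\models P^X$ and no proper subset of $X$ satisfies $P^X$. Weights of LP$^{\mathrm{MLN}}$ rules are omitted; $X$ is an LP$^{\mathrm{MLN}}$ stable model of $P$ iff $X$ is an ASP stable model of $\{r\in P: X\models r\}$. $P\equiv_{s,s}Q$ iff for every program $R$, $P\cup R$ and $Q\cup R$ have the same LP$^{\mathrm{MLN}}$ stable models. Programs are regarded as tuples of rules; $\langle P,Q\rangle$ is the concatenation. For a tuple $T=\langle r_1,\dots,r_n\rangle$ with atom set $at(T)$, let $\langle S_1,\dots,S_{3n}\rangle=\langle H(r_1),B^+(r_1),B^-(r_1),\dots,H(r_n),B^+(r_n),B^-(r_n)\rangle$; for nonempty $N'\subseteq\{1,\dots,3n\}$ the independent set is $I_{N'}=\bigcap_{i\in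 N'}S_i\setminus\bigcup_{j\notin N'}S_j$. For $i\in\{0,1\}$, the S-EX-$i$ transformation takes an independent set $I_{N'}$ with $|I_{N'}|=i$ and a fresh atom $a'\notin at(T)$ and adds $a'$ to each $S_j$ with $j\in N'$. For a pair $T=\langle P,Q\rangle$ the result is $\langle P^\oplus,Q^\oplus\rangle$ with $P^\oplus$ the first $|P|$ rules. A transformation type is SE-preserving if for every pair $\langle P,Q\rangle$ and every admissible application $P\equiv_{s,s}Q$ implies $P^\oplus\equiv_{s,s}Q^\oplus$, and NSE-preserving if $P\not\equiv_{s,s}Q$ implies $P^\oplus\not\equiv_{s,s}Q^\oplus$. *)

theory Defs
  imports "HOL-Library.FSet" "HOL-Library.Infinite_Typeclass"
begin

(* Head and bodies are finite; the head may be empty (constraints). *)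
datatype 'a rule = Rule (head: "'a fset") (pos_body: "'a fset") (neg_body: "'a fset")

definition satisfies :: "'a set \<Rightarrow> 'a rule \<Rightarrow> bool" where
  "satisfies X r \<longleftrightarrow>
     X \<inter> fset (head r) \<noteq> {} \<or> \<not> fset (pos_body r) \<subseteq> X \<or> fset (neg_body r) \<inter> X \<noteq> {}"

definition is_model :: "'a set \<Rightarrow> 'a rule set \<Rightarrow> bool" where
  "is_model X P \<longleftrightarrow> (\<forall>r\<in>P. satisfies X r)"

definition gl_reduct :: "'a rule set \<Rightarrow> 'a set \<Rightarrow> 'a rule set" where
  "gl_reduct P X = {Rule (head r) (pos_body r) {||} | r. r \<in> P \<and> fset (neg_body r) \<inter> X = {}}"

definition asp_stable_model :: "'a rule set \<Rightarrow> 'a set \<Rightarrow> bool" where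
  "asp_stable_model P X \<longleftrightarrow>
     is_model X (gl_reduct P X) \<and> \<not> (\<exists>Y. Y \<subset> X \<and> is_model Y (gl_reduct P X))"

definition lpmln_stable_model :: "'a rule set \<Rightarrow> 'a set \<Rightarrow> bool" where
  "lpmln_stable_model P X \<longleftrightarrow> asp_stable_model {r \<in> P. satisfies X r} X"

definition semi_strongly_equivalent :: "'a rule set \<Rightarrow> 'a rule set \<Rightarrow> bool" where
  "semi_strongly_equivalent P Q \<longleftrightarrow>
     (\<forall>R. finite R \<longrightarrow>
        {X. lpmln_stable_model (P \<union> R) X} = {X. lpmln_stable_model (Q \<union> R) X})"

definition atoms :: "'a rule list \<Rightarrow> 'a set" where
  "atoms T = (\<Union>r\<in>set T. fset (head r) \<union> fset (pos_body r) \<union> fset (neg_body r))"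

(* The sequence S_1, ..., S_{3n}; positions are counted from 0, so that the k-th rule (k < n)
   owns the positions 3k (head), 3k+1 (positive body) and 3k+2 (negative body). *)
definition components :: "'a rule list \<Rightarrow> 'a fset list" where
  "components T = concat (map (\<lambda>r. [head r, pos_body r, neg_body r]) T)"

definition independent_set :: "'a rule list \<Rightarrow> nat set \<Rightarrow> 'a set" where
  "independent_set T N =
     (\<Inter>i\<in>N. fset (components T ! i)) - (\<Union>j\<in>{..<3 * length T} - N. fset (components T ! j))"

definition add_atom :: "'a rule list \<Rightarrow> nat set \<Rightarrow> 'a \<Rightarrow> 'a rule list" where
  "add_atom T N a =
     (let ins = (\<lambda>j S. if j \<in> N then finsert a S else S)
      in map (\<lambda>k. Rule (ins (3 * k) (head (T ! k)))
                       (ins (3 * k + 1) (pos_body (T ! k)))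
                       (ins (3 * k + 2) (neg_body (T ! k)))) [0..<length T])"

(* A type of transformation, given as the relation between a tuple of rules and the results of
   its admissible applications. *)
type_synonym 'a transformation = "'a rule list \<Rightarrow> 'a rule list \<Rightarrow> bool"

definition s_ex :: "nat \<Rightarrow> 'a transformation" where
  "s_ex i T T' \<longleftrightarrow>
     (\<exists>N a. N \<noteq> {} \<and> N \<subseteq> {..<3 * length T} \<and> card (independent_set T N) = i \<and>
            a \<notin> atoms T \<and> T' = add_atom T N a)"

(* A program is a finite set of rules; as a tuple it is a repetition-free list enumerating that
   set. The concatenation P @ Q may still repeat the rules common to P and Q. *)
definition SE_preserving :: "'a transformation \<Rightarrow> bool" where
  "SE_preserving tr \<longleftrightarrow>
     (\<forall>P Q T'. distinct P \<and> distinct Q \<and> tr (P @ Q) T' \<and>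
        semi_strongly_equivalent (set P) (set Q) \<longrightarrow>
        semi_strongly_equivalent (set (take (length P) T')) (set (drop (length P) T')))"

definition NSE_preserving :: "'a transformation \<Rightarrow> bool" where
  "NSE_preserving tr \<longleftrightarrow>
     (\<forall>P Q T'. distinct P \<and> distinct Q \<and> tr (P @ Q) T' \<and>
        \<not> semi_strongly_equivalent (set P) (set Q) \<longrightarrow>
        \<not> semi_strongly_equivalent (set (take (length P) T')) (set (drop (length P) T')))"

end

theory Submission
  imports Defs
begin

text \<open>
  Semi-strong equivalence of finite programs means that \<open>P\<close> and \<open>Q\<close> have the same pairs \<open>Y \<subseteq> X\<close>
  such that \<open>Y\<close> is a model of the reduct, with respect to \<open>X\<close>, of the rules satisfied by \<open>X\<close>.
  If the independent set is a singleton \<open>{b}\<close>, then the fresh atom \<open>a\<close> becomes a twin of \<open>b\<close>, and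
  interpretations containing both or none of \<open>a\<close>, \<open>b\<close> see the new programs as the old ones; hence
  S-EX-1 preserves non-equivalence. Interpretations that separate the twins can destroy
  equivalence: \<open>{b \<or> c. b \<leftarrow> c. c \<leftarrow> b.}\<close> is equivalent to \<open>{b. c.}\<close>, but becomes
  \<open>{a \<or> b \<or> c. a \<or> b \<leftarrow> c. c \<leftarrow> a, b.}\<close> versus \<open>{a \<or> b. c.}\<close>, which \<open>Y = {a}\<close>, \<open>X = {a, b, c}\<close>
  tells apart. For S-EX-0, the constraint with empty body becomes a fact, and a fact becomes a rule
  with contradictory body.
\<close>

section \<open>Characterisation of semi-strong equivalence by pairs of interpretations\<close>

text \<open>The counterpart of an SE-model: rules violated by \<open>X\<close> are dropped instead
  of ruling \<open>X\<close> out.\<close>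

definition se_model :: "'a rule set \<Rightarrow> 'a set \<Rightarrow> 'a set \<Rightarrow> bool" where
  "se_model P Y X \<longleftrightarrow> is_model Y (gl_reduct {r \<in> P. satisfies X r} X)"

lemma se_model_iff:
  "se_model P Y X \<longleftrightarrow>
     (\<forall>r\<in>P. satisfies X r \<longrightarrow> fset (neg_body r) \<inter> X = {} \<longrightarrow>
        fset (pos_body r) \<subseteq> Y \<longrightarrow> Y \<inter> fset (head r) \<noteq> {})"
proof -
  have "gl_reduct {r \<in> P. satisfies X r} X = (\<lambda>r. Rule (head r) (pos_body r) {||}) `
      {r \<in> P. satisfies X r \<and> fset (neg_body r) \<inter> X = {}}"
    unfolding gl_reduct_def by blast
  then show ?thesis
    unfolding se_model_def is_model_def by (auto simp: satisfies_def[of Y])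
qed

lemma se_model_Un: "se_model (P \<union> Q) Y X \<longleftrightarrow> se_model P Y X \<and> se_model Q Y X"
  unfolding se_model_iff ball_Un ..

text \<open>Only rules satisfied by \<open>X\<close> enter the reduct, so stability of
  \<open>X\<close> comes down to minimality.\<close>

lemma se_model_refl: "se_model P X X"
  unfolding se_model_iff satisfies_def by blast

lemma lpmln_stable_model_iff:
  "lpmln_stable_model P X \<longleftrightarrow> (\<forall>Y. Y \<subset> X \<longrightarrow> \<not> se_model P Y X)"
  unfolding lpmln_stable_model_def asp_stable_model_def se_model_def[symmetric]
  by (simp add: se_model_refl)

text \<open>Only atoms occurring in \<open>P\<close> are ever tested. This lets an arbitrary
  \<open>X\<close> be cut down to a finite one, for which a separating context is a finite
  program.\<close>

lemma se_model_restrict: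
  assumes "\<And>r. r \<in> P \<Longrightarrow> fset (head r) \<union> fset (pos_body r) \<union> fset (neg_body r) \<subseteq> A"
  shows "se_model P (Y \<inter> A) (X \<inter> A) \<longleftrightarrow> se_model P Y X"
proof -
  have *: "\<And>r. r \<in> P \<Longrightarrow> fset (head r) \<subseteq> A \<and> fset (pos_body r) \<subseteq> A \<and> fset (neg_body r) \<subseteq> A"
    using assms by blast
  have "satisfies (X \<inter> A) r \<longleftrightarrow> satisfies X r"
    "fset (neg_body r) \<inter> (X \<inter> A) = fset (neg_body r) \<inter> X"
    "fset (pos_body r) \<subseteq> Y \<inter> A \<longleftrightarrow> fset (pos_body r) \<subseteq> Y"
    "Y \<inter> A \<inter> fset (head r) = Y \<inter> fset (head r)" if "r \<in> P" for r
    using *[OF that] unfolding satisfies_def by blast+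
  then show ?thesis unfolding se_model_iff by simp
qed

text \<open>A context \<open>R\<close> contributes the same conjunct on both sides, and stability of
  \<open>X\<close> only inspects subsets of \<open>X\<close>.\<close>

lemma semi_strongly_equivalentI:
  assumes "\<And>X Y. Y \<subseteq> X \<Longrightarrow> se_model P Y X \<longleftrightarrow> se_model Q Y X"
  shows "semi_strongly_equivalent P Q"
proof -
  have "lpmln_stable_model (P \<union> R) X \<longleftrightarrow> lpmln_stable_model (Q \<union> R) X" for R X
    unfolding lpmln_stable_model_iff se_model_Un using assms by (simp add: psubset_eq)
  then show ?thesis unfolding semi_strongly_equivalent_def by auto
qed

text \<open>
  The separating context consists of the facts in \<open>Y\<close> and a cycle through \<open>X - Y\<close>: below \<open>X\<close>,
  only \<open>Y\<close> and \<open>X\<close> itself are models of it.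
\<close>

lemma semi_strongly_equivalent_imp_se_model:
  assumes "semi_strongly_equivalent P Q" "finite X" "Y \<subseteq> X" "se_model P Y X"
  shows "se_model Q Y X"
proof (rule ccontr)
  assume nq: "\<not> se_model Q Y X"
  define R where "R = (\<lambda>x. Rule {|x|} {||} {||}) ` Y \<union>
    (\<lambda>(x, y). Rule {|x|} {|y|} {||}) ` ((X - Y) \<times> (X - Y))"
  have "finite Y" using assms(2,3) finite_subset by blast
  then have "finite R" unfolding R_def using assms(2) by blast
  have R_iff: "se_model R Z X \<longleftrightarrow> Y \<subseteq> Z \<and> (\<forall>x\<in>X - Y. \<forall>y\<in>X - Y. y \<in> Z \<longrightarrow> x \<in> Z)" for Z
    unfolding se_model_iff R_def satisfies_def using assms(3) by (auto simp: ball_Un)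
  have "se_model R Y X" by (auto simp: R_iff)
  moreover have "Y \<subset> X" using nq se_model_refl assms(3) by blast
  ultimately have "\<not> lpmln_stable_model (P \<union> R) X"
    using assms(4) by (auto simp: lpmln_stable_model_iff se_model_Un)
  moreover have "lpmln_stable_model (Q \<union> R) X"
    unfolding lpmln_stable_model_iff se_model_Un
  proof (intro allI impI notI)
    fix Z assume "Z \<subset> X" and Z: "se_model Q Z X \<and> se_model R Z X"
    \<comment> \<open>If \<open>Z\<close> met \<open>X - Y\<close>, the cycle would put all of
      \<open>X - Y\<close> into \<open>Z\<close>, forcing \<open>Z = X\<close>.\<close>
    then have "Z = Y" unfolding R_iff by blast
    with Z nq show False by blast
  qed
  ultimately show False
    using assms(1) \<open>finite R\<close> unfolding semi_strongly_equivalent_def by blast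
qed

lemma semi_strongly_equivalent_sym:
  "semi_strongly_equivalent P Q \<Longrightarrow> semi_strongly_equivalent Q P"
  unfolding semi_strongly_equivalent_def by simp

lemma semi_strongly_equivalent_iff:
  assumes "finite P" "finite Q"
  shows "semi_strongly_equivalent P Q \<longleftrightarrow>
    (\<forall>X Y. Y \<subseteq> X \<longrightarrow> (se_model P Y X \<longleftrightarrow> se_model Q Y X))"
proof
  assume eq: "semi_strongly_equivalent P Q"
  define A where
    "A = (\<Union>r\<in>P \<union> Q. fset (head r) \<union> fset (pos_body r) \<union> fset (neg_body r))"
  have "finite A" unfolding A_def using assms by simp
  show "\<forall>X Y. Y \<subseteq> X \<longrightarrow> (se_model P Y X \<longleftrightarrow> se_model Q Y X)"
  proof (intro allI impI)
    fix X Y :: "'a set" assume "Y \<subseteq> X"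
    then have sub: "Y \<inter> A \<subseteq> X \<inter> A" and fin: "finite (X \<inter> A)" using \<open>finite A\<close> by auto
    have "se_model P Y X \<longleftrightarrow> se_model P (Y \<inter> A) (X \<inter> A)"
      by (rule se_model_restrict[symmetric]) (auto simp: A_def)
    also have "\<dots> \<longleftrightarrow> se_model Q (Y \<inter> A) (X \<inter> A)"
      using semi_strongly_equivalent_imp_se_model[OF _ fin sub] eq
        semi_strongly_equivalent_sym[OF eq] by blast
    also have "\<dots> \<longleftrightarrow> se_model Q Y X"
      by (rule se_model_restrict) (auto simp: A_def)
    finally show "se_model P Y X \<longleftrightarrow> se_model Q Y X" .
  qed
qed (simp add: semi_strongly_equivalentI)

section \<open>Twin atoms\<close>

definition add_twin :: "'a \<Rightarrow> 'a \<Rightarrow> 'a fset \<Rightarrow> 'a fset" where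
  "add_twin b a S = (if b |\<in>| S then finsert a S else S)"

definition twin_rule :: "'a \<Rightarrow> 'a \<Rightarrow> 'a rule \<Rightarrow> 'a rule" where
  "twin_rule b a r =
     Rule (add_twin b a (head r)) (add_twin b a (pos_body r)) (add_twin b a (neg_body r))"

text \<open>Any \<open>a\<close> already in \<open>X\<close> is overruled: afterwards
  \<open>a\<close> is present exactly when \<open>b\<close> is.\<close>

definition twin_set :: "'a \<Rightarrow> 'a \<Rightarrow> 'a set \<Rightarrow> 'a set" where
  "twin_set b a X = (if b \<in> X then insert a X else X - {a})"

text \<open>Since \<open>a\<close> mirrors \<open>b\<close> in rules and interpretations alike,
  every inclusion and disjointness test keeps its truth value.\<close>

lemma se_model_twin:
  assumes "\<And>r. r \<in> P \<Longrightarrow> a \<notin> fset (head r) \<union> fset (pos_body r) \<union> fset (neg_body r)"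
  shows "se_model (twin_rule b a ` P) (twin_set b a Y) (twin_set b a X) \<longleftrightarrow> se_model P Y X"
proof -
  have mem: "x \<in> fset (add_twin b a S) \<longleftrightarrow> (if x = a then b \<in> fset S else x \<in> fset S)"
    if "a |\<notin>| S" for S x
    using that unfolding add_twin_def by auto
  have mem': "x \<in> twin_set b a Z \<longleftrightarrow> (if x = a then b \<in> Z else x \<in> Z)" for Z x
    unfolding twin_set_def by auto
  have sub: "fset (add_twin b a S) \<subseteq> twin_set b a Z \<longleftrightarrow> fset S \<subseteq> Z"
    and disj: "fset (add_twin b a S) \<inter> twin_set b a Z = {} \<longleftrightarrow> fset S \<inter> Z = {}"
    if "a |\<notin>| S" for S Z
    unfolding subset_iff disjoint_iff mem[OF that] mem' using that by metis+
  have fresh: "a |\<notin>| head r" "a |\<notin>| pos_body r" "a |\<notin>| neg_body r" if "r \<in> P" for r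
    using assms[OF that] by auto
  show ?thesis
    unfolding se_model_iff satisfies_def
    by (simp add: twin_rule_def fresh sub disj Int_commute[of "twin_set _ _ _"]
        Int_commute[of X] Int_commute[of Y])
qed

lemma components_nth:
  assumes "k < length T"
  shows "components T ! (3 * k) = head (T ! k)"
    "components T ! (3 * k + 1) = pos_body (T ! k)"
    "components T ! (3 * k + 2) = neg_body (T ! k)"
proof -
  have "components T ! (3 * k) = head (T ! k) \<and>
    components T ! (3 * k + 1) = pos_body (T ! k) \<and>
    components T ! (3 * k + 2) = neg_body (T ! k)"
    using assms
  proof (induction T arbitrary: k)
    case (Cons r T)
    show ?case
    proof (cases k)
      case (Suc m)
      then have "3 * k = Suc (Suc (Suc (3 * m)))" "k - Suc 0 = m" "k \<noteq> 0" "m < length T"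
        using Cons.prems by auto
      then show ?thesis using Cons.IH[of m] by (simp add: components_def nth_Cons')
    qed (simp add: components_def)
  qed simp
  then show "components T ! (3 * k) = head (T ! k)"
    "components T ! (3 * k + 1) = pos_body (T ! k)"
    "components T ! (3 * k + 2) = neg_body (T ! k)" by auto
qed

text \<open>An element \<open>b\<close> of the independent set determines \<open>N\<close> among the
  positions of \<open>T\<close>: they are those where \<open>b\<close> occurs.\<close>

lemma add_atom_eq_map_twin_rule:
  assumes "b \<in> independent_set T N"
  shows "add_atom T N a = map (twin_rule b a) T"
proof -
  have mem: "j \<in> N \<longleftrightarrow> b |\<in>| components T ! j" if "j < 3 * length T" for j
    using assms that unfolding independent_set_def by auto
  have "3 * k \<in> N \<longleftrightarrow> b |\<in>| head (T ! k)"
    "3 * k + 1 \<in> N \<longleftrightarrow> b |\<in>| pos_body (T ! k)"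
    "3 * k + 2 \<in> N \<longleftrightarrow> b |\<in>| neg_body (T ! k)" if "k < length T" for k
    using mem[of "3 * k"] mem[of "3 * k + 1"] mem[of "3 * k + 2"] components_nth[OF that] that
    by auto
  then show ?thesis
    unfolding add_atom_def Let_def
    by (intro nth_equalityI) (simp_all add: twin_rule_def add_twin_def)
qed

section \<open>The S-EX-1 transformation\<close>

text \<open>By contraposition: a pair for the old programs is lifted by \<open>twin_set b a\<close>,
  compared there, and pulled back.\<close>

lemma NSE_preserving_s_ex_1: "NSE_preserving (s_ex 1 :: 'a transformation)"
  unfolding NSE_preserving_def
proof (intro allI impI notI, elim conjE)
  fix P Q T' :: "'a rule list"
  assume "s_ex 1 (P @ Q) T'" and neq: "\<not> semi_strongly_equivalent (set P) (set Q)"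
    and eq: "semi_strongly_equivalent (set (take (length P) T')) (set (drop (length P) T'))"
  then obtain N a where "card (independent_set (P @ Q) N) = 1"
    and fresh: "a \<notin> atoms (P @ Q)" and T': "T' = add_atom (P @ Q) N a"
    unfolding s_ex_def by blast
  then obtain b where "b \<in> independent_set (P @ Q) N"
    by (auto simp: card_1_singleton_iff)
  then have "T' = map (twin_rule b a) P @ map (twin_rule b a) Q"
    by (simp add: T' add_atom_eq_map_twin_rule)
  then have twins: "semi_strongly_equivalent (twin_rule b a ` set P) (twin_rule b a ` set Q)"
    using eq by simp
  have "semi_strongly_equivalent (set P) (set Q)"
  proof (rule semi_strongly_equivalentI)
    fix X Y :: "'a set" assume "Y \<subseteq> X"
    then have "twin_set b a Y \<subseteq> twin_set b a X" by (auto simp: twin_set_def)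
    then have "se_model (twin_rule b a ` set P) (twin_set b a Y) (twin_set b a X) \<longleftrightarrow>
        se_model (twin_rule b a ` set Q) (twin_set b a Y) (twin_set b a X)"
      using twins by (simp add: semi_strongly_equivalent_iff)
    moreover have "a \<notin> fset (head r) \<union> fset (pos_body r) \<union> fset (neg_body r)"
      if "r \<in> set P \<union> set Q" for r
      using fresh that by (auto simp: atoms_def)
    ultimately show "se_model (set P) Y X \<longleftrightarrow> se_model (set Q) Y X"
      by (simp add: se_model_twin)
  qed
  with neq show False ..
qed

lemma not_SE_preserving_s_ex_1: "\<not> SE_preserving (s_ex 1 :: 'a::infinite transformation)"
proof
  assume pres: "SE_preserving (s_ex 1 :: 'a transformation)"
  fix b :: 'a
  obtain c where c: "c \<noteq> b" using ex_new_if_finite[OF infinite_UNIV, of "{b}"] by auto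
  obtain a where a: "a \<noteq> b" "a \<noteq> c" using ex_new_if_finite[OF infinite_UNIV, of "{b, c}"] by auto
  define P where "P = [Rule {|b, c|} {||} {||}, Rule {|b|} {|c|} {||}, Rule {|c|} {|b|} {||}]"
  define Q where "Q = [Rule {|b|} {||} {||}, Rule {|c|} {||} {||}]"
  define N where "N = {j. j < 3 * length (P @ Q) \<and> b |\<in>| components (P @ Q) ! j}"
  \<comment> \<open>Position 0 bounds the independent set by \<open>{b, c}\<close>; position 4, the
    body of \<open>b \<leftarrow> c\<close>, removes \<open>c\<close>.\<close>
  have nth: "components (P @ Q) ! 0 = {|b, c|}" "components (P @ Q) ! 4 = {|c|}"
    by (simp_all add: components_def P_def Q_def)
  have len: "length (P @ Q) = 5" by (simp add: P_def Q_def)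
  have N: "0 \<in> N" "4 \<notin> N" using c by (simp_all only: N_def mem_Collect_eq nth len) simp_all
  have ind: "independent_set (P @ Q) N = {b}"
  proof
    show "independent_set (P @ Q) N \<subseteq> {b}"
    proof
      fix x assume x: "x \<in> independent_set (P @ Q) N"
      have "x |\<in>| components (P @ Q) ! 0" "x |\<notin>| components (P @ Q) ! 4"
        using x N unfolding independent_set_def len by auto
      then show "x \<in> {b}" unfolding nth by auto
    qed
    show "{b} \<subseteq> independent_set (P @ Q) N" unfolding independent_set_def N_def by blast
  qed
  have "s_ex 1 (P @ Q) (add_atom (P @ Q) N a)"
    unfolding s_ex_def
  proof (intro exI conjI)
    show "card (independent_set (P @ Q) N) = 1" by (simp add: ind)
    show "a \<notin> atoms (P @ Q)" using a by (auto simp: atoms_def P_def Q_def)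
    show "N \<noteq> {}" using N by blast
  qed (auto simp: N_def)
  moreover have "add_atom (P @ Q) N a = map (twin_rule b a) P @ map (twin_rule b a) Q"
    using add_atom_eq_map_twin_rule[of b "P @ Q" N a] ind by simp
  ultimately have "s_ex 1 (P @ Q) (map (twin_rule b a) P @ map (twin_rule b a) Q)" by simp
  moreover have "distinct P" "distinct Q" using c by (auto simp: P_def Q_def)
  moreover have "semi_strongly_equivalent (set P) (set Q)"
  proof (rule semi_strongly_equivalentI)
    fix X Y :: "'a set" assume "Y \<subseteq> X"
    then have "b \<in> Y \<Longrightarrow> b \<in> X" "c \<in> Y \<Longrightarrow> c \<in> X" by auto
    \<comment> \<open>If \<open>X\<close> contains just one of \<open>b\<close>, \<open>c\<close>,
      the cycle rule leading from it to the other is violated and dropped; the remaining two rules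
      force that atom into \<open>Y\<close>.\<close>
    moreover have "se_model (set P) Y X \<longleftrightarrow> (b \<in> X \<or> c \<in> X \<longrightarrow> b \<in> Y \<or> c \<in> Y) \<and>
        ((c \<in> X \<longrightarrow> b \<in> X) \<longrightarrow> c \<in> Y \<longrightarrow> b \<in> Y) \<and>
        ((b \<in> X \<longrightarrow> c \<in> X) \<longrightarrow> b \<in> Y \<longrightarrow> c \<in> Y)"
      by (simp add: se_model_iff satisfies_def P_def)
    moreover have "se_model (set Q) Y X \<longleftrightarrow> (b \<in> X \<longrightarrow> b \<in> Y) \<and> (c \<in> X \<longrightarrow> c \<in> Y)"
      by (simp add: se_model_iff satisfies_def Q_def)
    ultimately show "se_model (set P) Y X \<longleftrightarrow> se_model (set Q) Y X" by blast
  qed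
  ultimately have
    "semi_strongly_equivalent (set (take (length P) (map (twin_rule b a) P @ map (twin_rule b a) Q)))
      (set (drop (length P) (map (twin_rule b a) P @ map (twin_rule b a) Q)))"
    using pres unfolding SE_preserving_def by blast
  then have "semi_strongly_equivalent (twin_rule b a ` set P) (twin_rule b a ` set Q)"
    by simp
  \<comment> \<open>The atom \<open>a\<close> alone satisfies the disjunction without triggering
    either implication, whereas the fact \<open>c\<close> fails in \<open>{a}\<close>.\<close>
  then have "se_model (twin_rule b a ` set P) {a} {a, b, c} \<longleftrightarrow>
      se_model (twin_rule b a ` set Q) {a} {a, b, c}"
    by (simp add: semi_strongly_equivalent_iff)
  moreover have "se_model (twin_rule b a ` set P) {a} {a, b, c}"
    using a c by (simp add: se_model_iff satisfies_def P_def twin_rule_def add_twin_def)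
  moreover have "\<not> se_model (twin_rule b a ` set Q) {a} {a, b, c}"
    using a c by (simp add: se_model_iff satisfies_def Q_def twin_rule_def add_twin_def)
  ultimately show False by blast
qed

section \<open>The S-EX-0 transformation\<close>

text \<open>The empty constraint is violated by every \<open>X\<close>, hence always dropped and
  equivalent to no rule; filling its head gives a fact.\<close>

lemma not_SE_preserving_s_ex_0: "\<not> SE_preserving (s_ex 0 :: 'a transformation)"
proof
  assume pres: "SE_preserving (s_ex 0 :: 'a transformation)"
  fix a :: 'a
  define P T where "P = [Rule {||} {||} {||} :: 'a rule]" and "T = [Rule {|a|} {||} {||}]"
  have T: "T = add_atom P {0} a"
    by (simp add: add_atom_def P_def T_def)
  have "s_ex 0 (P @ []) T"
    unfolding s_ex_def append_Nil2
  proof (intro exI conjI)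
    show "card (independent_set P {0}) = 0"
      by (simp add: independent_set_def components_def P_def)
    show "T = add_atom P {0} a" by (rule T)
  qed (auto simp: P_def atoms_def)
  moreover have "distinct P" "distinct ([] :: 'a rule list)" by (simp_all add: P_def)
  moreover have "semi_strongly_equivalent (set P) (set [])"
    by (rule semi_strongly_equivalentI) (simp add: se_model_iff satisfies_def P_def)
  ultimately have "semi_strongly_equivalent (set (take (length P) T)) (set (drop (length P) T))"
    using pres unfolding SE_preserving_def by blast
  then have "semi_strongly_equivalent {Rule {|a|} {||} {||}} {}"
    by (simp add: P_def T_def)
  then have "se_model {Rule {|a|} {||} {||}} {} {a} \<longleftrightarrow> se_model {} {} {a}"
    by (simp add: semi_strongly_equivalent_iff)
  then show False by (simp add: se_model_iff satisfies_def)
qed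

lemma not_NSE_preserving_s_ex_0: "\<not> NSE_preserving (s_ex 0 :: 'a::infinite transformation)"
proof
  assume pres: "NSE_preserving (s_ex 0 :: 'a transformation)"
  fix b :: 'a
  obtain a where a: "a \<noteq> b" using ex_new_if_finite[OF infinite_UNIV, of "{b}"] by auto
  define P T where "P = [Rule {|b|} {||} {||}]" and "T = [Rule {|b|} {|a|} {|a|}]"
  \<comment> \<open>Positions 1 and 2 are the two empty bodies of the fact, so their independent set
    is empty.\<close>
  have T: "T = add_atom P {1, 2} a"
    by (simp add: add_atom_def P_def T_def)
  have "s_ex 0 (P @ []) T"
    unfolding s_ex_def append_Nil2
  proof (intro exI conjI)
    show "card (independent_set P {1, 2}) = 0"
      by (simp add: independent_set_def components_def P_def)
    show "T = add_atom P {1, 2} a" by (rule T)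
  qed (use a in \<open>auto simp: P_def atoms_def\<close>)
  moreover have "distinct P" "distinct ([] :: 'a rule list)" by (simp_all add: P_def)
  moreover have "\<not> semi_strongly_equivalent (set P) (set [])"
  proof
    assume "semi_strongly_equivalent (set P) (set [])"
    then have "se_model (set P) {} {b} \<longleftrightarrow> se_model (set []) {} {b}"
      unfolding semi_strongly_equivalent_iff[OF finite_set finite_set] by blast
    then show False by (simp add: se_model_iff satisfies_def P_def)
  qed
  ultimately have "\<not> semi_strongly_equivalent (set (take (length P) T)) (set (drop (length P) T))"
    using pres unfolding NSE_preserving_def by blast
  \<comment> \<open>The body would need \<open>a \<in> Y \<subseteq> X\<close> and
    \<open>a \<notin> X\<close>.\<close>
  moreover have "semi_strongly_equivalent {Rule {|b|} {|a|} {|a|}} {}"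
    by (rule semi_strongly_equivalentI) (auto simp: se_model_iff satisfies_def)
  ultimately show False by (simp add: P_def T_def)
qed

theorem theorem6:
  shows "\<not> SE_preserving (s_ex 0 :: 'a::infinite transformation)
       \<and> \<not> NSE_preserving (s_ex 0 :: 'a transformation)
       \<and> NSE_preserving (s_ex 1 :: 'a transformation)
       \<and> \<not> SE_preserving (s_ex 1 :: 'a transformation)"
  using not_SE_preserving_s_ex_0 not_NSE_preserving_s_ex_0 NSE_preserving_s_ex_1
    not_SE_preserving_s_ex_1 by blast

end
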